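(* Let $m\ge 1$ and $1\le s<n$ be integers. There is a function $c:(0,\infty)\to(0,\infty)$ (depending only on $m,n,s$) with the following property. Let $A=(a_{i_1\cdots i_m\bar{j}_1\cdots\bar{j}_m})$ be a $2m$-th order $n$-dimensional Hermitian tensor. Let $B$ be the $s$-dimensional Hermitian sub-tensor of $A$ consisting of the entries all of whose indices $i_1,\dots,i_m,j_1,\dots,j_m$ lie in $\{1,\dots,s\}$, let $D$ be the $(n-s)$-dimensional Hermitian sub-tensor consisting of the entries all of whose indices lie in $\{s+1,\dots,n\}$, and let $K$ be the maximum of $|a_{i_1\cdots i_m\bar{j}_1\cdots\bar{j}_m}|$ over all entries of $A$ having at least one index $\le s$ and at least one index $\ge s+1$; assume $K>0$. Suppose that $B$ and $D$ are Hermitian positive definite and that $K_1,K_2>0$ are such that every $\hat{H}$-eigenvalue of $S_B$ is $\ge K_1$ and every $\hat{H}$-eigenvalue of $S_D$ is $\ge K_2$. If $\dfrac{K_2}{K}\ge c\!\left(\dfrac{K}{K_1}\right)$, then $A$ is Hermitian positive definite.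
   Context: A $2m$-th order $n$-dimensional complex tensor is an array $A=(a_{i_1\cdots i_m\bar{j}_1\cdots \bar{j}_m})$ of complex numbers indexed by $1\le i_1,\dots,i_m,j_1,\dots,j_m\le n$ (the bars on the last $m$ indices are only notation). It is Hermitian if $\overline{a_{i_1\cdots i_m\bar{j}_1\cdots \bar{j}_m}}=a_{j_1\cdots j_m\bar{i}_1\cdots \bar{i}_m}$ for all indices. It is Hermitian positive definite if $\sum a_{i_1\cdots i_m\bar{j}_1\cdots \bar{j}_m}x_{i_1}\cdots x_{i_m}\overline{x_{j_1}}\cdots\overline{x_{j_m}}>0$ for every $\mathbf{x}\in\mathbb{C}^n\setminus\{0\}$, the sum being over all indices from $1$ to $n$. The conjugate partial symmetrization of a $2m$-th order Hermitian tensor $T=(t_{i_1\cdots i_m\bar{j}_1\cdots\bar{j}_m})$ is $S_T=(b_{i_1\cdots i_m\bar{j}_1\cdots\bar{j}_m})$, $b_{i_1\cdots i_m\bar{j}_1\cdots\bar{j}_m}=\frac{1}{(m!)^2}\sum_{\sigma,\tau\in S_m}t_{i_{\sigma(1)}\cdots i_{\sigma(m)}\bar{j}_{\tau(1)}\cdots\bar{j}_{\tau(m)}}$, with $S_m$ the group of permutations of $\{1,\dots,m\}$. For a $2m$-th order $N$-dimensional tensor $T$, $\lambda\in\mathbb{C}$ is an $\hat{H}$-eigenvalue if there is $\mathbf{x}\in\mathbb{C}^N\setminus\{0\}$ such that for all $1\le i\le N$, $\sum_{i_2,\dots,i_m,j_1,\dots,j_m=1}^N t_{ii_2\cdots i_m\bar{j}_1\cdots\bar{j}_m}x_{i_2}\cdots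 x_{i_m}\overline{x_{j_1}}\cdots\overline{x_{j_m}}=\lambda\,\bar{x}_i|x_i|^{2m-2}$ (with $|x_i|^0=1$ when $m=1$). The $\hat{H}$-eigenvalues of $S_T$ are real when $T$ is Hermitian. The tensor $D$ is regarded as an $(n-s)$-dimensional tensor by relabelling the indices $s+1,\dots,n$ as $1,\dots,n-s$. *)

theory Defs
  imports "HOL-Analysis.Analysis" "HOL-Combinatorics.List_Permutation"
begin

text \<open>
  A tensor of order \<open>2m\<close> and dimension \<open>n\<close> is a function of two index lists (the unbarred indices
  \<open>i\<^sub>1, \<dots>, i\<^sub>m\<close> and the barred ones \<open>j\<^sub>1, \<dots>, j\<^sub>m\<close>), and a vector is a function on indices.  The
  parameters \<open>m\<close> and \<open>n\<close> are passed separately: only values at lists in \<open>index_lists n m\<close>, resp. at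
  indices in \<open>{1..n}\<close>, belong to the object, and values elsewhere are never inspected.
\<close>

type_synonym ctensor = "nat list \<Rightarrow> nat list \<Rightarrow> complex"

definition index_lists :: "nat \<Rightarrow> nat \<Rightarrow> nat list set" where
  "index_lists n m = {is. length is = m \<and> set is \<subseteq> {1..n}}"

definition nonzero_vec :: "nat \<Rightarrow> (nat \<Rightarrow> complex) \<Rightarrow> bool" where
  "nonzero_vec n x \<longleftrightarrow> (\<exists>k\<in>{1..n}. x k \<noteq> 0)"

definition monom_at :: "(nat \<Rightarrow> complex) \<Rightarrow> nat list \<Rightarrow> complex" where
  "monom_at x is = prod_list (map x is)"

definition hermitian_tensor :: "nat \<Rightarrow> nat \<Rightarrow> ctensor \<Rightarrow> bool" where
  "hermitian_tensor m n A \<longleftrightarrow>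
     (\<forall>is\<in>index_lists n m. \<forall>js\<in>index_lists n m. cnj (A is js) = A js is)"

definition hermitian_form :: "nat \<Rightarrow> nat \<Rightarrow> ctensor \<Rightarrow> (nat \<Rightarrow> complex) \<Rightarrow> complex" where
  "hermitian_form m n A x =
     (\<Sum>is\<in>index_lists n m. \<Sum>js\<in>index_lists n m. A is js * monom_at x is * cnj (monom_at x js))"

definition hermitian_pos_def :: "nat \<Rightarrow> nat \<Rightarrow> ctensor \<Rightarrow> bool" where
  "hermitian_pos_def m n A \<longleftrightarrow> hermitian_tensor m n A \<and>
     (\<forall>x. nonzero_vec n x \<longrightarrow> hermitian_form m n A x \<in> \<real> \<and> 0 < Re (hermitian_form m n A x))"

text \<open>
  \<open>permute_list \<sigma> is\<close> has the entry \<open>is ! \<sigma> k\<close> at position \<open>k\<close>.  Positions in lists are counted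
  from 0, so the symmetric group acts on \<open>{..<m}\<close>.
\<close>

definition conj_partial_symm :: "nat \<Rightarrow> ctensor \<Rightarrow> ctensor" where
  "conj_partial_symm m T = (\<lambda>is js.
     1 / (fact m)\<^sup>2 * (\<Sum>\<sigma> | \<sigma> permutes {..<m}. \<Sum>\<tau> | \<tau> permutes {..<m}.
       T (permute_list \<sigma> is) (permute_list \<tau> js)))"

text \<open>For \<open>m = 1\<close> the factor \<open>cmod (x i) ^ 0\<close> below is \<open>1\<close>, also when \<open>x i = 0\<close>.\<close>

definition H_hat_eigenvalue :: "nat \<Rightarrow> nat \<Rightarrow> ctensor \<Rightarrow> complex \<Rightarrow> bool" where
  "H_hat_eigenvalue m n T lam \<longleftrightarrow>
     (\<exists>x. nonzero_vec n x \<and>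
       (\<forall>i\<in>{1..n}.
         (\<Sum>is\<in>index_lists n (m - 1). \<Sum>js\<in>index_lists n m.
            T (i # is) js * monom_at x is * cnj (monom_at x js))
         = lam * cnj (x i) * of_real (cmod (x i) ^ (2 * m - 2))))"

text \<open>
  The sub-tensor on the indices \<open>d + 1, d + 2, \<dots>\<close>, relabelled as \<open>1, 2, \<dots>\<close>; its dimension is
  the one passed along with it.
\<close>

definition sub_tensor :: "nat \<Rightarrow> ctensor \<Rightarrow> ctensor" where
  "sub_tensor d A = (\<lambda>is js. A (map (\<lambda>k. k + d) is) (map (\<lambda>k. k + d) js))"

text \<open>
  For \<open>m \<ge> 1\<close> and \<open>1 \<le> s < n\<close> the set below is finite and nonempty, so \<open>Max\<close> is the true maximum.
\<close>

definition mixed_max :: "nat \<Rightarrow> nat \<Rightarrow> nat \<Rightarrow> ctensor \<Rightarrow> real" where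
  "mixed_max m n s A =
     Max {cmod (A is js) | is js. is \<in> index_lists n m \<and> js \<in> index_lists n m \<and>
            (\<exists>k \<in> set is \<union> set js. k \<le> s) \<and> (\<exists>k \<in> set is \<union> set js. s + 1 \<le> k)}"

end

theory Submission
  imports Defs
begin

text \<open>
  Minimise the form of \<open>T\<close> on the compact set \<open>\<Sum>\<bar>x\<^sub>k\<bar>\<^sup>2\<^sup>m = 1\<close>.  The form of \<open>T\<close> equals that of
  its symmetrization, and the Lagrange condition at a minimiser is the eigenvalue equation of the
  symmetrization, with the minimum as eigenvalue.  Hence the forms of \<open>B\<close> and \<open>D\<close> are bounded below
  by \<open>K\<^sub>1 Y\<^sup>2\<^sup>m\<close> and \<open>K\<^sub>2 Z\<^sup>2\<^sup>m\<close>, where \<open>Y\<close> and \<open>Z\<close> are the largest absolute values of the first \<open>s\<close>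
  and of the last \<open>n - s\<close> coordinates.

  A mixed monomial has a factor from each group.  With \<open>C = n\<^sup>2\<^sup>m\<close>, the number of all entries, and
  \<open>d = 1 + C K / K\<^sub>1\<close>: if \<open>Z \<le> Y / d\<close>, one factor gains \<open>1 / d\<close> and the mixed part is at most
  \<open>C K Y\<^sup>2\<^sup>m / d < K\<^sub>1 Y\<^sup>2\<^sup>m\<close>; otherwise all coordinates are at most \<open>d Z\<close>, and the mixed part is at most
  \<open>C K d\<^sup>2\<^sup>m Z\<^sup>2\<^sup>m\<close>, which is below \<open>K\<^sub>2 Z\<^sup>2\<^sup>m\<close> for \<open>c(t) = (C + 1) (1 + C t)\<^sup>2\<^sup>m\<close>.
\<close>

section \<open>Index lists, monomials, and elementary properties of the form\<close>

lemma finite_index_lists [simp]: "finite (index_lists n m)"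
  unfolding index_lists_def
  using finite_lists_length_eq[of "{1..n}" m] by (simp add: conj_commute)

lemma index_lists_0 [simp]: "index_lists n 0 = {[]}"
  by (auto simp: index_lists_def)

lemma sum_index_lists_Suc:
  fixes g :: "nat list \<Rightarrow> 'a::comm_monoid_add"
  shows "(\<Sum>is\<in>index_lists n (Suc m). g is) = (\<Sum>a\<in>{1..n}. \<Sum>is\<in>index_lists n m. g (a # is))"
proof -
  have eq: "index_lists n (Suc m) = (\<lambda>(a, is). a # is) ` ({1..n} \<times> index_lists n m)"
    by (force simp: index_lists_def length_Suc_conv image_iff)
  have inj: "inj_on (\<lambda>(a, is). a # is) ({1..n} \<times> index_lists n m)"
    by (auto simp: inj_on_def)
  show ?thesis
    unfolding eq sum.reindex[OF inj] sum.cartesian_product by (simp add: case_prod_unfold)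
qed

lemma monom_at_Nil [simp]: "monom_at x [] = 1"
  and monom_at_Cons [simp]: "monom_at x (a # is) = x a * monom_at x is"
  and monom_at_append: "monom_at x (is @ js) = monom_at x is * monom_at x js"
  by (simp_all add: monom_at_def)

lemma monom_at_cong:
  assumes "\<And>k. k \<in> set is \<Longrightarrow> x k = y k"
  shows "monom_at x is = monom_at y is"
  unfolding monom_at_def using assms by (simp cong: map_cong)

lemma monom_at_mset: "mset is = mset js \<Longrightarrow> monom_at x is = monom_at x js"
  unfolding monom_at_def by (metis mset_map prod_mset_prod_list)

lemma monom_at_scale: "monom_at (\<lambda>k. c * x k) is = c ^ length is * monom_at x is"
  by (induction "is") (auto simp: algebra_simps)

lemma continuous_on_monom_at: "continuous_on S (\<lambda>x. monom_at x is)"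
proof (induction "is")
  case (Cons a "is")
  have "continuous_on S (\<lambda>x::nat \<Rightarrow> complex. x a)"
    by (rule continuous_on_subset[OF continuous_on_product_coordinates]) simp
  with Cons show ?case by (auto intro!: continuous_intros)
qed simp

lemma hermitian_form_cong:
  assumes "\<And>k. k \<in> {1..n} \<Longrightarrow> x k = y k"
  shows "hermitian_form m n A x = hermitian_form m n A y"
proof -
  have "monom_at x is = monom_at y is" if "is \<in> index_lists n m" for "is"
    using that assms by (intro monom_at_cong) (auto simp: index_lists_def)
  then show ?thesis unfolding hermitian_form_def by (intro sum.cong refl) auto
qed

text \<open>Each term has \<open>m\<close> factors from \<open>x\<close> and \<open>m\<close> from
  its conjugate, and conjugation fixes the real factor \<open>r\<close>. This homogeneity reduces
  lower bounds to the unit sphere.\<close>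

lemma hermitian_form_scale:
  "hermitian_form m n A (\<lambda>k. of_real r * x k) = of_real (r ^ (2 * m)) * hermitian_form m n A x"
proof -
  have "A is js * monom_at (\<lambda>k. of_real r * x k) is * cnj (monom_at (\<lambda>k. of_real r * x k) js) =
      of_real (r ^ (2 * m)) * (A is js * monom_at x is * cnj (monom_at x js))"
    if "is \<in> index_lists n m" "js \<in> index_lists n m" for "is" js
  proof -
    have len: "length is = m" "length js = m" using that by (auto simp: index_lists_def)
    show ?thesis unfolding monom_at_scale len mult_2 power_add by simp
  qed
  then show ?thesis unfolding hermitian_form_def sum_distrib_left by (intro sum.cong refl) blast
qed

lemma continuous_on_hermitian_form: "continuous_on S (hermitian_form m n A)"
  unfolding hermitian_form_def by (intro continuous_intros continuous_on_monom_at)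

text \<open>Conjugation turns the term at \<open>(is, js)\<close> into the term at
  \<open>(js, is)\<close>, so the double sum is its own conjugate.\<close>

lemma hermitian_form_Reals:
  assumes "hermitian_tensor m n A"
  shows "hermitian_form m n A x \<in> \<real>"
proof -
  have "cnj (hermitian_form m n A x) =
      (\<Sum>is\<in>index_lists n m. \<Sum>js\<in>index_lists n m. A js is * cnj (monom_at x is) * monom_at x js)"
    using assms unfolding hermitian_form_def hermitian_tensor_def cnj_sum
    by (intro sum.cong refl) simp
  also have "\<dots> = hermitian_form m n A x"
    unfolding hermitian_form_def by (subst sum.swap) (simp add: mult_ac)
  finally show ?thesis by (simp add: Reals_cnj_iff)
qed

section \<open>Derivatives of monomials and Euler's relation\<close>

text \<open>The product rule along the list: every position holding \<open>i\<close> contributes one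
  term, so multiplicities arise without counting exponents.\<close>

primrec monom_deriv :: "(nat \<Rightarrow> complex) \<Rightarrow> nat \<Rightarrow> nat list \<Rightarrow> complex" where
  "monom_deriv x i [] = 0"
| "monom_deriv x i (a # is) = (if a = i then monom_at x is else 0) + x a * monom_deriv x i is"

text \<open>The parameter \<open>t\<close> is real and the direction \<open>u\<close> complex
  because the form also contains conjugates and is only real differentiable in
  \<open>x\<close>.\<close>

lemma has_vector_derivative_monom_at:
  "((\<lambda>t. monom_at (x(i := x i + of_real t * u)) is) has_vector_derivative u * monom_deriv x i is)
     (at 0)"
proof (induction "is")
  case (Cons a "is")
  have x: "((\<lambda>t. (x(i := x i + of_real t * u)) a) has_vector_derivative (if a = i then u else 0)) (at 0)"
    by (auto intro!: derivative_eq_intros has_vector_derivative_real_field simp: has_vector_derivative_def scaleR_conv_of_real)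
  show ?case
    using has_vector_derivative_mult[OF x Cons] by (auto simp: algebra_simps)
qed simp

text \<open>Euler's relation for symmetric coefficients: the \<open>m\<close> positions at which \<open>i\<close> can be
  differentiated away contribute equally.\<close>

lemma sum_monom_deriv:
  assumes "\<And>is js. length is = m \<Longrightarrow> mset is = mset js \<Longrightarrow> F is = F js"
    and i: "i \<in> {1..n}"
  shows "(\<Sum>is\<in>index_lists n m. F is * monom_deriv x i is) =
    of_nat m * (\<Sum>is\<in>index_lists n (m - 1). F (i # is) * monom_at x is)"
  using assms(1)
proof (induction m arbitrary: F)
  case (Suc m)
  have IH: "(\<Sum>is\<in>index_lists n m. F (a # is) * monom_deriv x i is) =
    of_nat m * (\<Sum>is\<in>index_lists n (m - 1). F (a # i # is) * monom_at x is)" for a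
    by (rule Suc.IH) (rule Suc.prems, auto)
  \<comment> \<open>Symmetry of \<open>F\<close> exchanges the first two indices and so brings
    \<open>i\<close> to the front. For \<open>m = 0\<close>, where \<open>m - 1\<close> is
    truncated, both sides vanish through the factor \<open>of_nat m\<close>.\<close>
  have tail: "of_nat m * (\<Sum>a\<in>{1..n}. x a * (\<Sum>is\<in>index_lists n (m - 1). F (a # i # is) * monom_at x is))
      = of_nat m * (\<Sum>is\<in>index_lists n m. F (i # is) * monom_at x is)"
  proof (cases m)
    case (Suc k)
    have "F (a # i # is) = F (i # a # is)" if "is \<in> index_lists n k" for a "is"
      using that Suc by (intro Suc.prems) (auto simp: index_lists_def)
    then show ?thesis
      by (simp add: Suc sum_index_lists_Suc sum_distrib_left mult_ac cong: sum.cong)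
  qed simp
  have "(\<Sum>is\<in>index_lists n (Suc m). F is * monom_deriv x i is) =
     (\<Sum>a\<in>{1..n}. (if a = i then \<Sum>is\<in>index_lists n m. F (a # is) * monom_at x is else 0)
        + x a * (\<Sum>is\<in>index_lists n m. F (a # is) * monom_deriv x i is))"
    unfolding sum_index_lists_Suc
    by (intro sum.cong refl) (auto simp: sum.distrib sum_distrib_left algebra_simps)
  also have "\<dots> = (\<Sum>is\<in>index_lists n m. F (i # is) * monom_at x is)
      + of_nat m * (\<Sum>a\<in>{1..n}. x a * (\<Sum>is\<in>index_lists n (m - 1). F (a # i # is) * monom_at x is))"
    using i by (simp add: sum.distrib sum.delta IH sum_distrib_left mult_ac)
  finally show ?case unfolding tail by (simp add: algebra_simps)
qed simp

section \<open>Conjugate partial symmetrization\<close>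

text \<open>Two lists with the same multiset differ by a permutation, and composing with it only
  reindexes the sum over \<open>\<sigma>\<close>.\<close>

lemma conj_partial_symm_left_mset:
  assumes "length is = m" "mset is = mset is'"
  shows "conj_partial_symm m T is js = conj_partial_symm m T is' js"
proof -
  obtain \<pi> where \<pi>: "\<pi> permutes {..<length is'}" "permute_list \<pi> is' = is"
    using mset_eq_permutation[OF assms(2)] by blast
  have len: "length is' = m" using assms mset_eq_length by metis
  have "(\<Sum>\<sigma> | \<sigma> permutes {..<m}. \<Sum>\<tau> | \<tau> permutes {..<m}.
       T (permute_list \<sigma> is) (permute_list \<tau> js)) =
     (\<Sum>\<sigma> | \<sigma> permutes {..<m}. \<Sum>\<tau> | \<tau> permutes {..<m}.
       T (permute_list (\<pi> \<circ> \<sigma>) is') (permute_list \<tau> js))"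
    using \<pi> len by (intro sum.cong refl) (auto simp: permute_list_compose)
  also have "\<dots> = (\<Sum>\<sigma> | \<sigma> permutes {..<m}. \<Sum>\<tau> | \<tau> permutes {..<m}.
       T (permute_list \<sigma> is') (permute_list \<tau> js))"
    using \<pi>(1) unfolding len by (rule setum_permutations_compose_left[symmetric])
  finally show ?thesis by (simp add: conj_partial_symm_def)
qed

lemma permute_list_index_lists:
  assumes "\<sigma> permutes {..<m}" "is \<in> index_lists n m"
  shows "permute_list \<sigma> is \<in> index_lists n m"
  using assms by (auto simp: index_lists_def)

text \<open>Conjugation exchanges the two arguments of \<open>T\<close>; interchanging the two
  averages restores the form of the definition.\<close>

lemma hermitian_conj_partial_symm:
  assumes "hermitian_tensor m n T"
  shows "hermitian_tensor m n (conj_partial_symm m T)"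
  unfolding hermitian_tensor_def
proof (intro ballI)
  fix "is" js assume ij: "is \<in> index_lists n m" "js \<in> index_lists n m"
  have "(\<Sum>\<sigma> | \<sigma> permutes {..<m}. \<Sum>\<tau> | \<tau> permutes {..<m}.
      cnj (T (permute_list \<sigma> is) (permute_list \<tau> js))) =
    (\<Sum>\<sigma> | \<sigma> permutes {..<m}. \<Sum>\<tau> | \<tau> permutes {..<m}.
      T (permute_list \<tau> js) (permute_list \<sigma> is))"
    using assms ij unfolding hermitian_tensor_def
    by (intro sum.cong refl) (auto intro: permute_list_index_lists)
  also have "\<dots> = (\<Sum>\<tau> | \<tau> permutes {..<m}. \<Sum>\<sigma> | \<sigma> permutes {..<m}.
      T (permute_list \<tau> js) (permute_list \<sigma> is))"
    by (rule sum.swap)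
  finally show "cnj (conj_partial_symm m T is js) = conj_partial_symm m T js is"
    by (simp add: conj_partial_symm_def)
qed

lemma bij_betw_permute_list_index_lists:
  assumes "\<sigma> permutes {..<m}"
  shows "bij_betw (permute_list \<sigma>) (index_lists n m) (index_lists n m)"
proof (rule bij_betw_byWitness[where f' = "permute_list (inv \<sigma>)"])
  have inv: "inv \<sigma> permutes {..<m}" by (rule permutes_inv[OF assms])
  show "permute_list \<sigma> ` index_lists n m \<subseteq> index_lists n m"
    "permute_list (inv \<sigma>) ` index_lists n m \<subseteq> index_lists n m"
    using assms inv by (auto intro: permute_list_index_lists)
  show "\<forall>is\<in>index_lists n m. permute_list (inv \<sigma>) (permute_list \<sigma> is) = is"
    using assms inv
    by (auto simp: index_lists_def permute_list_compose[symmetric] permutes_inv_o)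
  show "\<forall>is\<in>index_lists n m. permute_list \<sigma> (permute_list (inv \<sigma>) is) = is"
    using assms inv
    by (auto simp: index_lists_def permute_list_compose[symmetric] permutes_inv_o)
qed

text \<open>A monomial does not see the order of its indices, so permuting positions is a mere
  reindexing of the sum.\<close>

lemma sum_permute_list_index_lists:
  fixes g :: "nat list \<Rightarrow> complex"
  assumes "\<sigma> permutes {..<m}"
  shows "(\<Sum>is\<in>index_lists n m. g (permute_list \<sigma> is) * monom_at x is) =
    (\<Sum>is\<in>index_lists n m. g is * monom_at x is)"
proof -
  have "(\<Sum>is\<in>index_lists n m. g (permute_list \<sigma> is) * monom_at x is) =
    (\<Sum>is\<in>index_lists n m. g (permute_list \<sigma> is) * monom_at x (permute_list \<sigma> is))"
    using assms by (intro sum.cong refl arg_cong2[where f = "(*)"] monom_at_mset)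
      (auto simp: index_lists_def)
  also have "\<dots> = (\<Sum>is\<in>index_lists n m. g is * monom_at x is)"
    using bij_betw_permute_list_index_lists[OF assms]
    by (rule sum.reindex_bij_betw)
  finally show ?thesis .
qed

lemma hermitian_form_permute:
  assumes "\<sigma> permutes {..<m}" "\<tau> permutes {..<m}"
  shows "hermitian_form m n (\<lambda>is js. T (permute_list \<sigma> is) (permute_list \<tau> js)) x =
    hermitian_form m n T x"
proof -
  \<comment> \<open>The conjugated monomial is a monomial in the conjugated vector, which lets the
    reindexing apply to the barred indices too.\<close>
  have cnj_monom: "cnj (monom_at x is) = monom_at (\<lambda>k. cnj (x k)) is" for "is"
    by (induction "is") auto
  have "hermitian_form m n (\<lambda>is js. T (permute_list \<sigma> is) (permute_list \<tau> js)) x =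
    (\<Sum>is\<in>index_lists n m. (\<Sum>js\<in>index_lists n m.
       T (permute_list \<sigma> is) (permute_list \<tau> js) * monom_at (\<lambda>k. cnj (x k)) js) * monom_at x is)"
    by (simp add: hermitian_form_def cnj_monom sum_distrib_left sum_distrib_right mult_ac)
  also have "\<dots> = (\<Sum>is\<in>index_lists n m. (\<Sum>js\<in>index_lists n m.
       T (permute_list \<sigma> is) js * monom_at (\<lambda>k. cnj (x k)) js) * monom_at x is)"
    by (simp add: sum_permute_list_index_lists[OF assms(2)])
  also have "\<dots> = (\<Sum>is\<in>index_lists n m. (\<Sum>js\<in>index_lists n m.
       T is js * monom_at (\<lambda>k. cnj (x k)) js) * monom_at x is)"
    by (rule sum_permute_list_index_lists[OF assms(1)])
  also have "\<dots> = hermitian_form m n T x"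
    by (simp add: hermitian_form_def cnj_monom sum_distrib_left sum_distrib_right mult_ac)
  finally show ?thesis .
qed

lemma hermitian_form_sum:
  "hermitian_form m n (\<lambda>is js. c * (\<Sum>s\<in>S. A s is js)) x = c * (\<Sum>s\<in>S. hermitian_form m n (A s) x)"
proof -
  have "hermitian_form m n (\<lambda>is js. c * (\<Sum>s\<in>S. A s is js)) x =
    (\<Sum>is\<in>index_lists n m. \<Sum>js\<in>index_lists n m. \<Sum>s\<in>S.
       c * (A s is js * monom_at x is * cnj (monom_at x js)))"
    by (simp add: hermitian_form_def sum_distrib_left sum_distrib_right mult_ac)
  also have "\<dots> = (\<Sum>s\<in>S. \<Sum>is\<in>index_lists n m. \<Sum>js\<in>index_lists n m.
       c * (A s is js * monom_at x is * cnj (monom_at x js)))"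
    by (subst sum.swap, subst (2) sum.swap) (rule refl)
  finally show ?thesis by (simp add: hermitian_form_def sum_distrib_left)
qed

text \<open>The symmetrization averages \<open>(m!)^2\<close> tensors that all have the form of
  \<open>T\<close>.\<close>

lemma hermitian_form_conj_partial_symm:
  "hermitian_form m n (conj_partial_symm m T) x = hermitian_form m n T x"
proof -
  let ?P = "{\<sigma>. \<sigma> permutes {..<m}}"
  have card: "card ?P = fact m" by (simp add: card_permutations)
  have "conj_partial_symm m T = (\<lambda>is js. 1 / (fact m)\<^sup>2 * (\<Sum>p\<in>?P \<times> ?P.
      T (permute_list (fst p) is) (permute_list (snd p) js)))"
    by (simp add: conj_partial_symm_def sum.cartesian_product case_prod_unfold)
  then have "hermitian_form m n (conj_partial_symm m T) x = 1 / (fact m)\<^sup>2 * (\<Sum>p\<in>?P \<times> ?P.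
      hermitian_form m n (\<lambda>is js. T (permute_list (fst p) is) (permute_list (snd p) js)) x)"
    by (simp only: hermitian_form_sum)
  also have "\<dots> = 1 / (fact m)\<^sup>2 * (\<Sum>p\<in>?P \<times> ?P. hermitian_form m n T x)"
    by (intro arg_cong2[where f = "(*)"] sum.cong refl) (auto simp: hermitian_form_permute)
  also have "\<dots> = hermitian_form m n T x"
    by (simp add: card card_cartesian_product power2_eq_square)
  finally show ?thesis .
qed

section \<open>First variation and the Lagrange condition\<close>

text \<open>Differentiating the unbarred monomial gives \<open>u * G x i\<close>. Differentiating
  the barred one gives the conjugate of this, by Hermitian symmetry and an exchange of the two
  sums.\<close>

lemma hermitian_form_has_vector_derivative:
  assumes "hermitian_tensor m n S"
  defines "G \<equiv> \<lambda>x i. \<Sum>is\<in>index_lists n m. \<Sum>js\<in>index_lists n m.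
      S is js * monom_deriv x i is * cnj (monom_at x js)"
  shows "((\<lambda>t. hermitian_form m n S (x(i := x i + of_real t * u))) has_vector_derivative
    u * G x i + cnj (u * G x i)) (at 0)"
proof -
  let ?I = "index_lists n m" and ?y = "\<lambda>t. x(i := x i + of_real t * u)"
  have y0: "?y 0 = x" by auto
  have 1: "((\<lambda>t. S is js * monom_at (?y t) is * cnj (monom_at (?y t) js)) has_vector_derivative
      (S is js * monom_at x is) * cnj (u * monom_deriv x i js)
      + S is js * (u * monom_deriv x i is) * cnj (monom_at x js)) (at 0)" for "is" js
    using has_vector_derivative_mult[OF
        has_vector_derivative_mult_right[OF has_vector_derivative_monom_at[of x i u "is"], of "S is js"]
        has_vector_derivative_cnj[OF has_vector_derivative_monom_at[of x i u js]]]
    by (simp only: y0 of_real_0 mult_zero_left add_0_right fun_upd_triv)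
  have "((\<lambda>t. hermitian_form m n S (?y t)) has_vector_derivative
      (\<Sum>is\<in>?I. \<Sum>js\<in>?I. (S is js * monom_at x is) * cnj (u * monom_deriv x i js)
      + S is js * (u * monom_deriv x i is) * cnj (monom_at x js))) (at 0)"
    unfolding hermitian_form_def by (intro has_vector_derivative_sum 1)
  also have "(\<Sum>is\<in>?I. \<Sum>js\<in>?I. (S is js * monom_at x is) * cnj (u * monom_deriv x i js)
      + S is js * (u * monom_deriv x i is) * cnj (monom_at x js)) =
    (\<Sum>is\<in>?I. \<Sum>js\<in>?I. (S is js * monom_at x is) * cnj (u * monom_deriv x i js)) + u * G x i"
    by (simp add: sum.distrib G_def sum_distrib_left mult_ac)
  also have "(\<Sum>is\<in>?I. \<Sum>js\<in>?I. (S is js * monom_at x is) * cnj (u * monom_deriv x i js)) =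
    (\<Sum>is\<in>?I. \<Sum>js\<in>?I. cnj (u * (S js is * monom_deriv x i js * cnj (monom_at x is))))"
  proof (intro sum.cong refl)
    fix "is" js assume "is \<in> ?I" "js \<in> ?I"
    then have "cnj (S js is) = S is js" using assms by (simp add: hermitian_tensor_def)
    then show "(S is js * monom_at x is) * cnj (u * monom_deriv x i js) =
        cnj (u * (S js is * monom_deriv x i js * cnj (monom_at x is)))" by simp
  qed
  also have "\<dots> = cnj (u * G x i)"
    by (subst sum.swap) (simp add: G_def sum_distrib_left)
  finally show ?thesis by (simp only: add.commute)
qed

lemma has_real_derivative_cmod_power:
  "((\<lambda>t. cmod (z + of_real t * u) ^ (2 * m)) has_real_derivative
     real m * cmod z ^ (2 * m - 2) * (2 * Re (u * cnj z))) (at 0)"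
proof -
  \<comment> \<open>An even power of the modulus is a polynomial in the real and imaginary parts, so
    the derivative also exists where \<open>z = 0\<close>.\<close>
  have pow: "cmod w ^ (2 * k) = ((Re w)\<^sup>2 + (Im w)\<^sup>2) ^ k" for w k
    by (simp add: power_mult cmod_power2)
  have m2: "2 * m - 2 = 2 * (m - 1)" by simp
  show ?thesis
    unfolding m2 pow
    by (auto intro!: derivative_eq_intros simp: algebra_simps)
qed

text \<open>The form minus \<open>\<mu>\<close> times the power sum is nonnegative everywhere and
  zero at \<open>x\<close>. The minimum is thus unconstrained, and the derivative at
  \<open>x\<close> vanishes along every complex direction \<open>u\<close> in coordinate
  \<open>i\<close>.\<close>

lemma hermitian_form_minimizer:
  assumes m: "1 \<le> m" and i: "i \<in> {1..n}" and herm: "hermitian_tensor m n S"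
    and sym: "\<And>is is' js. length is = m \<Longrightarrow> mset is = mset is' \<Longrightarrow> S is js = S is' js"
    and ge: "\<And>y. \<mu> * (\<Sum>k=1..n. cmod (y k) ^ (2 * m)) \<le> Re (hermitian_form m n S y)"
    and eq: "Re (hermitian_form m n S x) = \<mu> * (\<Sum>k=1..n. cmod (x k) ^ (2 * m))"
  shows "(\<Sum>is\<in>index_lists n (m - 1). \<Sum>js\<in>index_lists n m.
            S (i # is) js * monom_at x is * cnj (monom_at x js)) =
    of_real \<mu> * cnj (x i) * of_real (cmod (x i) ^ (2 * m - 2))"
proof -
  define G where "G = (\<Sum>is\<in>index_lists n m. \<Sum>js\<in>index_lists n m.
      S is js * monom_deriv x i is * cnj (monom_at x js))"
  \<comment> \<open>Chosen so that the derivative of the difference along \<open>u\<close> is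
    \<open>2 * Re (u * W)\<close>.\<close>
  define W where "W = G - of_nat m * (of_real \<mu> * cnj (x i) * of_real (cmod (x i) ^ (2 * m - 2)))"
  have "Re (u * W) = 0" for u
  proof -
    let ?y = "\<lambda>t::real. x(i := x i + of_real t * u)"
    define g where "g t = Re (hermitian_form m n S (?y t)) - \<mu> * (\<Sum>k=1..n. cmod (?y t k) ^ (2 * m))"
      for t
    \<comment> \<open>Only the summand at \<open>i\<close> depends on \<open>t\<close>.\<close>
    have N: "(\<Sum>k=1..n. cmod (?y t k) ^ (2 * m)) =
        cmod (x i + of_real t * u) ^ (2 * m) + (\<Sum>k\<in>{1..n} - {i}. cmod (x k) ^ (2 * m))" for t
      using i by (simp add: sum.remove[of _ i])
    have "((\<lambda>t. Re (hermitian_form m n S (?y t))) has_real_derivative Re (u * G + cnj (u * G))) (at 0)"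
      using hermitian_form_has_vector_derivative[OF herm, of x i u]
      unfolding has_vector_derivative_complex_iff G_def by blast
    then have "(g has_real_derivative Re (u * G + cnj (u * G))
        - \<mu> * (real m * cmod (x i) ^ (2 * m - 2) * (2 * Re (u * cnj (x i))) + 0)) (at 0)"
      unfolding g_def N
      by (intro DERIV_diff DERIV_cmult DERIV_add DERIV_const has_real_derivative_cmod_power)
    moreover have "g 0 \<le> g t" for t
      using ge[of "?y t"] eq by (simp add: g_def)
    ultimately have "Re (u * G + cnj (u * G))
        - \<mu> * (real m * cmod (x i) ^ (2 * m - 2) * (2 * Re (u * cnj (x i))) + 0) = 0"
      by (intro DERIV_local_min[of g _ 0 1]) auto
    moreover have ReW: "Re (u * W) =
        Re (u * G) - \<mu> * (real m * cmod (x i) ^ (2 * m - 2) * Re (u * cnj (x i)))"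
    proof -
      have "u * W = u * G - of_real (\<mu> * (real m * cmod (x i) ^ (2 * m - 2))) * (u * cnj (x i))"
        by (simp add: W_def algebra_simps)
      then show ?thesis by (simp only: minus_complex.simps Re_complex_of_real times_complex.simps Im_complex_of_real)
    qed
    have "2 * Re (u * W) = Re (u * G + cnj (u * G))
        - \<mu> * (real m * cmod (x i) ^ (2 * m - 2) * (2 * Re (u * cnj (x i))) + 0)"
      unfolding ReW by (simp add: algebra_simps)
    ultimately show ?thesis by linarith
  qed
  \<comment> \<open>With \<open>u = cnj W\<close> the real part is the squared modulus of
    \<open>W\<close>.\<close>
  from this[of "cnj W"] have "W = 0"
    by (simp add: complex_eq_iff sum_squares_eq_zero_iff)
  \<comment> \<open>Euler's relation produces the factor \<open>m\<close> that \<open>W\<close> also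
    carries in its second term; it cancels as \<open>m \<ge> 1\<close>.\<close>
  moreover have "G = of_nat m * (\<Sum>is\<in>index_lists n (m - 1). \<Sum>js\<in>index_lists n m.
            S (i # is) js * monom_at x is * cnj (monom_at x js))"
  proof -
    have "G = (\<Sum>is\<in>index_lists n m.
        (\<Sum>js\<in>index_lists n m. S is js * cnj (monom_at x js)) * monom_deriv x i is)"
      by (simp add: G_def sum_distrib_left sum_distrib_right mult_ac)
    also have "\<dots> = of_nat m * (\<Sum>is\<in>index_lists n (m - 1).
        (\<Sum>js\<in>index_lists n m. S (i # is) js * cnj (monom_at x js)) * monom_at x is)"
    proof (rule sum_monom_deriv[OF _ i])
      fix "is" is' :: "nat list" assume "length is = m" "mset is = mset is'"
      then show "(\<Sum>js\<in>index_lists n m. S is js * cnj (monom_at x js)) =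
          (\<Sum>js\<in>index_lists n m. S is' js * cnj (monom_at x js))"
        by (intro sum.cong refl) (simp add: sym[of "is" is'])
    qed
    finally show ?thesis by (simp add: sum_distrib_left sum_distrib_right mult_ac)
  qed
  ultimately show ?thesis using m by (simp add: W_def)
qed

section \<open>The minimum on the unit sphere is an eigenvalue\<close>

text \<open>Functions on all indices carry the product topology. Fixing the coordinates outside
  \<open>{1..n}\<close> to 0 makes the sphere a closed part of a product of discs and points, which
  is compact by Tychonoff's theorem.\<close>

lemma compact_unit_sphere_power:
  "compact {x :: nat \<Rightarrow> complex. (\<forall>k. k \<notin> {1..n} \<longrightarrow> x k = 0) \<and> (\<Sum>k=1..n. cmod (x k) ^ (2 * m)) = 1}"
  if "1 \<le> m"
proof -
  let ?N = "\<lambda>x :: nat \<Rightarrow> complex. \<Sum>k=1..n. cmod (x k) ^ (2 * m)"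
  let ?B = "\<lambda>k. if k \<in> {1..n} then cball (0::complex) 1 else {0}"
  have "compactin (product_topology (\<lambda>i. euclidean) UNIV) (PiE UNIV ?B)"
    by (subst compactin_PiE) auto
  then have "compact (PiE UNIV ?B)"
    by (simp only: euclidean_product_topology compactin_euclidean_iff)
  moreover have "closed {x. ?N x = 1}"
    by (intro closed_Collect_eq continuous_intros continuous_on_product_coordinates)
  ultimately have "compact (PiE UNIV ?B \<inter> {x. ?N x = 1})"
    by (rule compact_Int_closed)
  also have "PiE UNIV ?B \<inter> {x. ?N x = 1} = {x. (\<forall>k. k \<notin> {1..n} \<longrightarrow> x k = 0) \<and> ?N x = 1}"
  proof (intro equalityI subsetI)
    fix x assume x: "x \<in> {x. (\<forall>k. k \<notin> {1..n} \<longrightarrow> x k = 0) \<and> ?N x = 1}"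
    have "cmod (x k) \<le> 1" if "k \<in> {1..n}" for k
    proof -
      have "cmod (x k) ^ (2 * m) \<le> ?N x" using that by (intro member_le_sum) auto
      then have "cmod (x k) ^ (2 * m) \<le> 1 ^ (2 * m)" using x by simp
      then show ?thesis using \<open>1 \<le> m\<close> by (subst (asm) power_mono_iff) auto
    qed
    then show "x \<in> PiE UNIV ?B \<inter> {x. ?N x = 1}" using x by auto
  qed (auto simp: PiE_iff split: if_splits)
  finally show ?thesis .
qed

lemma hermitian_form_ge_eigenvalue_bound:
  assumes m: "1 \<le> m" and n: "1 \<le> n" and herm: "hermitian_tensor m n T"
    and eig: "\<And>lam. H_hat_eigenvalue m n (conj_partial_symm m T) lam \<Longrightarrow> K \<le> Re lam"
  shows "K * (\<Sum>k=1..n. cmod (x k) ^ (2 * m)) \<le> Re (hermitian_form m n T x)"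
proof -
  let ?N = "\<lambda>x :: nat \<Rightarrow> complex. \<Sum>k=1..n. cmod (x k) ^ (2 * m)"
  define S where "S = {x :: nat \<Rightarrow> complex. (\<forall>k. k \<notin> {1..n} \<longrightarrow> x k = 0) \<and> ?N x = 1}"
  let ?f = "\<lambda>x. Re (hermitian_form m n T x)"
  \<comment> \<open>The first unit vector shows that the sphere is nonempty.\<close>
  have "cmod (if k = 1 then 1 else 0) ^ (2 * m) = (if k = 1 then 1 else 0)" for k :: nat
    using m by simp
  then have "?N (\<lambda>k. if k = 1 then 1 else 0) = 1"
    using n by (simp only: sum.delta) simp
  then have "(\<lambda>k. if k = 1 then 1 else 0) \<in> S"
    using n by (simp add: S_def)
  then have "S \<noteq> {}" by blast
  moreover have "continuous_on S ?f"
    by (intro continuous_on_Re continuous_on_hermitian_form)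
  ultimately have "\<exists>p\<in>S. \<forall>y\<in>S. ?f p \<le> ?f y"
    by (rule continuous_attains_inf[OF compact_unit_sphere_power[OF m, of n, folded S_def]])
  then obtain p where p: "p \<in> S" and min: "\<And>y. y \<in> S \<Longrightarrow> ?f p \<le> ?f y"
    by blast
  \<comment> \<open>Homogeneity extends the minimum property from the sphere to all vectors.\<close>
  have ge: "?f p * ?N y \<le> ?f y" for y
  proof (cases "\<exists>k\<in>{1..n}. y k \<noteq> 0")
    case True
    define r where "r = root (2 * m) (?N y)"
    have Npos: "0 < ?N y"
    proof -
      from True obtain k where k: "k \<in> {1..n}" "y k \<noteq> 0" by blast
      have "0 < cmod (y k) ^ (2 * m)" using k by simp
      also have "\<dots> \<le> ?N y" using k by (intro member_le_sum) auto
      finally show ?thesis .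
    qed
    then have r: "0 < r" "r ^ (2 * m) = ?N y" using m by (auto simp: r_def)
    \<comment> \<open>Besides normalising, \<open>z\<close> is cut off outside
      \<open>{1..n}\<close>, as membership in \<open>S\<close> demands; the form does not see those
      coordinates.\<close>
    define z where "z k = (if k \<in> {1..n} then y k / of_real r else 0)" for k
    have "?N z = (\<Sum>k=1..n. cmod (y k) ^ (2 * m) / r ^ (2 * m))"
      using r by (intro sum.cong refl) (simp add: z_def norm_divide power_divide)
    also have "\<dots> = 1" using r Npos by (simp add: sum_divide_distrib[symmetric])
    finally have "z \<in> S" by (simp add: z_def S_def)
    then have "?f p \<le> ?f z" by (rule min)
    moreover have "hermitian_form m n T y = hermitian_form m n T (\<lambda>k. of_real r * z k)"
      using r by (intro hermitian_form_cong) (simp add: z_def)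
    then have "?f y = ?N y * ?f z"
      unfolding hermitian_form_scale r(2) by (simp only: times_complex.simps Re_complex_of_real Im_complex_of_real)
    ultimately show ?thesis using Npos by (simp add: mult.commute)
  next
    case False
    have "hermitian_form m n T y = hermitian_form m n T (\<lambda>k. of_real 0 * y k)"
      using False by (intro hermitian_form_cong) auto
    also have "\<dots> = 0" using m by (simp only: hermitian_form_scale) (simp add: power_0_left)
    finally show ?thesis using False m by (simp add: power_0_left)
  qed
  have "H_hat_eigenvalue m n (conj_partial_symm m T) (of_real (?f p))"
    unfolding H_hat_eigenvalue_def
  proof (intro exI conjI ballI)
    show "nonzero_vec n p"
    proof (rule ccontr)
      assume "\<not> nonzero_vec n p"
      then have "?N p = 0" using m by (simp add: nonzero_vec_def power_0_left)
      with p show False by (simp add: S_def)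
    qed
  next
    fix i assume "i \<in> {1..n}"
    then show "(\<Sum>is\<in>index_lists n (m - 1). \<Sum>js\<in>index_lists n m.
            conj_partial_symm m T (i # is) js * monom_at p is * cnj (monom_at p js)) =
        of_real (?f p) * cnj (p i) * of_real (cmod (p i) ^ (2 * m - 2))"
      \<comment> \<open>Applied to the symmetrization, whose form agrees with that of
        \<open>T\<close>, with \<open>\<mu> = ?f p\<close>; equality at \<open>p\<close> holds
        because \<open>?N p = 1\<close>.\<close>
      using ge p
      by (intro hermitian_form_minimizer m hermitian_conj_partial_symm herm
            conj_partial_symm_left_mset)
         (auto simp: S_def hermitian_form_conj_partial_symm)
  qed
  then have "K \<le> ?f p" using eig by fastforce
  then have "K * ?N x \<le> ?f p * ?N x"
    by (intro mult_right_mono sum_nonneg) auto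
  with ge[of x] show ?thesis by linarith
qed

section \<open>Bounds for monomials and for mixed entries\<close>

lemma norm_monom_at_le:
  assumes "\<And>k. k \<in> set is \<Longrightarrow> cmod (x k) \<le> Y"
  shows "cmod (monom_at x is) \<le> Y ^ length is"
  using assms
proof (induction "is")
  case (Cons a "is")
  have "0 \<le> Y" using order_trans[OF norm_ge_zero Cons.prems[of a]] by simp
  with Cons show ?case by (auto simp: norm_mult intro!: mult_mono)
qed simp

text \<open>Split the list at one occurrence of \<open>j\<close>: that factor contributes
  \<open>e * Y\<close>, and every other factor at most \<open>Y\<close>.\<close>

lemma norm_monom_at_le_small_factor:
  assumes "\<And>k. k \<in> set is \<Longrightarrow> cmod (x k) \<le> Y" and "j \<in> set is" "cmod (x j) \<le> e * Y"
  shows "cmod (monom_at x is) \<le> e * Y ^ length is"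
proof -
  obtain us vs where eq: "is = us @ j # vs" using split_list[OF assms(2)] by blast
  have u: "cmod (monom_at x us) \<le> Y ^ length us" and v: "cmod (monom_at x vs) \<le> Y ^ length vs"
    using assms(1) by (auto simp: eq intro!: norm_monom_at_le)
  have "0 \<le> Y" using assms(1,2) norm_ge_zero order_trans by blast
  have "0 \<le> e * Y" using assms(3) norm_ge_zero order_trans by blast
  have "cmod (monom_at x is) = cmod (monom_at x us) * (cmod (x j) * cmod (monom_at x vs))"
    by (simp add: eq monom_at_append norm_mult)
  also have "\<dots> \<le> Y ^ length us * (e * Y * Y ^ length vs)"
    using assms(3) u v \<open>0 \<le> Y\<close> \<open>0 \<le> e * Y\<close> by (intro mult_mono) auto
  also have "\<dots> = e * Y ^ length is" by (simp add: eq power_add mult_ac)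
  finally show ?thesis .
qed

text \<open>The index set behind \<open>mixed_max\<close>, as a set of pairs so that it can be
  summed over and counted.\<close>

definition mixed_pairs :: "nat \<Rightarrow> nat \<Rightarrow> nat \<Rightarrow> (nat list \<times> nat list) set" where
  "mixed_pairs m n s = {(is, js). is \<in> index_lists n m \<and> js \<in> index_lists n m \<and>
     (\<exists>k \<in> set is \<union> set js. k \<le> s) \<and> (\<exists>k \<in> set is \<union> set js. s + 1 \<le> k)}"

lemma mixed_pairs_subset: "mixed_pairs m n s \<subseteq> index_lists n m \<times> index_lists n m"
  by (auto simp: mixed_pairs_def)

lemma finite_mixed_pairs: "finite (mixed_pairs m n s)"
  by (rule finite_subset[OF mixed_pairs_subset]) simp

lemma norm_le_mixed_max:
  assumes "(is, js) \<in> mixed_pairs m n s"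
  shows "cmod (A is js) \<le> mixed_max m n s A"
proof -
  have "{cmod (A is js) | is js. is \<in> index_lists n m \<and> js \<in> index_lists n m \<and>
            (\<exists>k \<in> set is \<union> set js. k \<le> s) \<and> (\<exists>k \<in> set is \<union> set js. s + 1 \<le> k)} =
    (\<lambda>(is, js). cmod (A is js)) ` mixed_pairs m n s"
    by (auto simp: mixed_pairs_def image_iff)
  then have "mixed_max m n s A = Max ((\<lambda>(is, js). cmod (A is js)) ` mixed_pairs m n s)"
    by (simp add: mixed_max_def)
  then show ?thesis
    using assms finite_mixed_pairs by (auto intro!: Max_ge)
qed

section \<open>Splitting the form into two blocks and a mixed part\<close>

lemma index_lists_shift:
  assumes "s \<le> n"
  shows "map (\<lambda>k. k + s) ` index_lists (n - s) m = {is. length is = m \<and> set is \<subseteq> {s + 1..n}}"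
proof (intro equalityI subsetI)
  fix "is" assume "is \<in> {is. length is = m \<and> set is \<subseteq> {s + 1..n}}"
  then have len: "length is = m" and set: "\<And>k. k \<in> set is \<Longrightarrow> s + 1 \<le> k \<and> k \<le> n" by auto
  have "map (\<lambda>k. k - s) is \<in> index_lists (n - s) m"
    using len set by (fastforce simp: index_lists_def)
  moreover have "is = map (\<lambda>k. k + s) (map (\<lambda>k. k - s) is)"
    unfolding map_map by (rule map_idI[symmetric]) (use set in fastforce)
  ultimately show "is \<in> map (\<lambda>k. k + s) ` index_lists (n - s) m" by blast
qed (use assms in \<open>fastforce simp: index_lists_def\<close>)

text \<open>Undoing the relabelling exhibits the form of a sub-tensor as a block of the sum for
  \<open>A\<close>. Shift 0 covers the leading block as well.\<close>

lemma hermitian_form_sub_tensor: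
  assumes "s \<le> n"
  shows "hermitian_form m (n - s) (sub_tensor s A) (\<lambda>k. x (k + s)) =
    (\<Sum>(is, js)\<in>{is. length is = m \<and> set is \<subseteq> {s + 1..n}} \<times> {is. length is = m \<and> set is \<subseteq> {s + 1..n}}.
       A is js * monom_at x is * cnj (monom_at x js))"
proof -
  have inj: "inj_on (map (\<lambda>k. k + s)) (index_lists (n - s) m)"
    by (rule inj_on_subset[OF inj_mapI]) (auto simp: inj_on_def)
  have "monom_at x (map (\<lambda>k. k + s) is) = monom_at (\<lambda>k. x (k + s)) is" for "is"
    by (simp add: monom_at_def o_def)
  then show ?thesis
    unfolding index_lists_shift[OF assms, symmetric] sum.cartesian_product[symmetric]
      sum.reindex[OF inj] o_def hermitian_form_def sub_tensor_def by simp
qed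

text \<open>The indices of a pair of lists lie all below or at \<open>s\<close>, all above it, or on
  both sides.\<close>

lemma hermitian_form_split:
  assumes "1 \<le> m" "s \<le> n"
  shows "hermitian_form m n A x = hermitian_form m s (sub_tensor 0 A) x
    + hermitian_form m (n - s) (sub_tensor s A) (\<lambda>k. x (k + s))
    + (\<Sum>(is, js)\<in>mixed_pairs m n s. A is js * monom_at x is * cnj (monom_at x js))"
proof -
  let ?g = "\<lambda>(is, js). A is js * monom_at x is * cnj (monom_at x js)"
  let ?L = "{is. length is = m \<and> set is \<subseteq> {0 + 1..s}}"
  let ?U = "{is. length is = m \<and> set is \<subseteq> {s + 1..n}}"
  have "(?L \<times> ?L \<union> ?U \<times> ?U) \<union> mixed_pairs m n s = index_lists n m \<times> index_lists n m"
    using assms(2)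
    by (auto simp: index_lists_def mixed_pairs_def subset_iff)
       (metis UnI1 UnI2 not_less_eq_eq Suc_le_mono)+
  moreover have fin: "finite ?L" "finite ?U"
    using finite_lists_length_eq[of "{0 + 1..s}" m] finite_lists_length_eq[of "{s + 1..n}" m]
    by (simp_all add: conj_commute)
  have "(?L \<times> ?L \<union> ?U \<times> ?U) \<inter> mixed_pairs m n s = {}"
    by (fastforce simp: mixed_pairs_def)
  \<comment> \<open>This needs \<open>m \<ge> 1\<close>: the head of a list cannot lie on both sides
    of \<open>s\<close>, whereas the empty list would belong to both blocks.\<close>
  moreover have "(?L \<times> ?L) \<inter> (?U \<times> ?U) = {}"
  proof -
    have "?L \<inter> ?U = {}"
    proof (rule ccontr)
      assume "?L \<inter> ?U \<noteq> {}"
      then obtain "is" where "is": "length is = m" "set is \<subseteq> {0 + 1..s}" "set is \<subseteq> {s + 1..n}" by blast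
      then have "hd is \<in> set is" using assms(1) by (intro hd_in_set) auto
      with "is"(2,3) show False by fastforce
    qed
    then show ?thesis by blast
  qed
  ultimately have "sum ?g (index_lists n m \<times> index_lists n m) =
      sum ?g (?L \<times> ?L) + sum ?g (?U \<times> ?U) + sum ?g (mixed_pairs m n s)"
    using fin finite_mixed_pairs[of m n s]
    by (metis (no_types, lifting) finite_SigmaI finite_UnI sum.union_disjoint)
  moreover have "hermitian_form m s (sub_tensor 0 A) x = sum ?g (?L \<times> ?L)"
    using hermitian_form_sub_tensor[of 0 s m A x] by simp
  moreover have "hermitian_form m n A x = sum ?g (index_lists n m \<times> index_lists n m)"
    by (simp add: hermitian_form_def sum.cartesian_product)
  ultimately show ?thesis by (simp only: hermitian_form_sub_tensor[OF assms(2)])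
qed

lemma norm_mixed_sum_le:
  assumes "\<And>is js. (is, js) \<in> mixed_pairs m n s \<Longrightarrow> cmod (monom_at x (is @ js)) \<le> R"
    and "0 \<le> mixed_max m n s A" and "0 \<le> R"
  shows "cmod (\<Sum>(is, js)\<in>mixed_pairs m n s. A is js * monom_at x is * cnj (monom_at x js)) \<le>
    real (card (index_lists n m \<times> index_lists n m)) * (mixed_max m n s A * R)"
proof -
  have "cmod (\<Sum>(is, js)\<in>mixed_pairs m n s. A is js * monom_at x is * cnj (monom_at x js)) \<le>
    real (card (mixed_pairs m n s)) * (mixed_max m n s A * R)"
  proof (rule sum_norm_bound, clarify)
    fix "is" js assume ij: "(is, js) \<in> mixed_pairs m n s"
    have "cmod (A is js * monom_at x is * cnj (monom_at x js)) =
        cmod (A is js) * cmod (monom_at x (is @ js))"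
      by (simp add: norm_mult monom_at_append)
    also have "\<dots> \<le> mixed_max m n s A * R"
      using ij assms by (intro mult_mono norm_le_mixed_max) auto
    finally show "cmod (A is js * monom_at x is * cnj (monom_at x js)) \<le> mixed_max m n s A * R" .
  qed
  \<comment> \<open>Counting all pairs is crude but gives a constant depending on \<open>m\<close>
    and \<open>n\<close> only.\<close>
  also have "\<dots> \<le> real (card (index_lists n m \<times> index_lists n m)) * (mixed_max m n s A * R)"
    using assms by (intro mult_right_mono of_nat_mono card_mono mixed_pairs_subset) auto
  finally show ?thesis .
qed

text \<open>The maximum is attained at some coordinate, whose power is one of the nonnegative
  summands.\<close>

lemma Max_norm_power_le_sum:
  assumes "finite I" "I \<noteq> {}"
  shows "Max ((\<lambda>k. cmod (x k)) ` I) ^ p \<le> (\<Sum>k\<in>I. cmod (x k) ^ p)"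
proof -
  have "Max ((\<lambda>k. cmod (x k)) ` I) \<in> (\<lambda>k. cmod (x k)) ` I" using assms by (intro Max_in) auto
  then obtain k where k: "k \<in> I" "Max ((\<lambda>k. cmod (x k)) ` I) = cmod (x k)" by blast
  have "cmod (x k) ^ p \<le> (\<Sum>k\<in>I. cmod (x k) ^ p)"
    using assms k by (intro member_le_sum) auto
  with k show ?thesis by simp
qed

section \<open>The comparison of the mixed part with the two blocks\<close>

theorem proposition4p16:
  fixes m n s :: nat
  assumes "1 \<le> m" and "1 \<le> s" and "s < n"
  shows "\<exists>c :: real \<Rightarrow> real. (\<forall>t>0. 0 < c t) \<and>
    (\<forall>A :: ctensor. \<forall>K K1 K2 :: real.
       hermitian_tensor m n A \<longrightarrow>
       K = mixed_max m n s A \<longrightarrow> 0 < K \<longrightarrow>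
       hermitian_pos_def m s (sub_tensor 0 A) \<longrightarrow>
       hermitian_pos_def m (n - s) (sub_tensor s A) \<longrightarrow>
       0 < K1 \<longrightarrow> 0 < K2 \<longrightarrow>
       (\<forall>lam. H_hat_eigenvalue m s (conj_partial_symm m (sub_tensor 0 A)) lam \<longrightarrow> K1 \<le> Re lam) \<longrightarrow>
       (\<forall>lam. H_hat_eigenvalue m (n - s) (conj_partial_symm m (sub_tensor s A)) lam \<longrightarrow> K2 \<le> Re lam) \<longrightarrow>
       c (K / K1) \<le> K2 / K \<longrightarrow>
       hermitian_pos_def m n A)"
proof -
  define C where "C = real (card (index_lists n m \<times> index_lists n m))"
  have C: "0 \<le> C" by (simp add: C_def)
  \<comment> \<open>At \<open>t = K / K1\<close> the base of the power is the threshold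
    \<open>d\<close> used below. Taking \<open>C + 1\<close> instead of \<open>C\<close> makes the
    comparison with \<open>K2\<close> strict.\<close>
  define c where "c t = (C + 1) * (1 + C * t) ^ (2 * m)" for t
  have c_pos: "0 < c t" if "0 < t" for t
  proof -
    have "0 < 1 + C * t" using C that by (simp add: add_pos_nonneg)
    then show ?thesis using C by (simp add: c_def)
  qed
  have "hermitian_pos_def m n A"
    if herm: "hermitian_tensor m n A" and K: "K = mixed_max m n s A" "0 < K"
      and B: "hermitian_pos_def m s (sub_tensor 0 A)"
      and D: "hermitian_pos_def m (n - s) (sub_tensor s A)"
      and K12: "0 < K1" "0 < K2"
      and eigB: "\<forall>lam. H_hat_eigenvalue m s (conj_partial_symm m (sub_tensor 0 A)) lam \<longrightarrow> K1 \<le> Re lam"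
      and eigD: "\<forall>lam. H_hat_eigenvalue m (n - s) (conj_partial_symm m (sub_tensor s A)) lam \<longrightarrow> K2 \<le> Re lam"
      and cK: "c (K / K1) \<le> K2 / K"
    for A K K1 K2
    unfolding hermitian_pos_def_def
  proof (intro conjI allI impI)
    fix x assume x: "nonzero_vec n x"
    define Y where "Y = Max ((\<lambda>k. cmod (x k)) ` {1..s})"
    define Z where "Z = Max ((\<lambda>k. cmod (x k)) ` {s + 1..n})"
    \<comment> \<open>This choice gives \<open>d \<ge> 1\<close> and
      \<open>K1 * d = K1 + C * K\<close>, hence \<open>C * K / d < K1\<close>.\<close>
    define d where "d = 1 + C * (K / K1)"
    define M where "M = (\<Sum>(is, js)\<in>mixed_pairs m n s. A is js * monom_at x is * cnj (monom_at x js))"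
    have d: "1 \<le> d" using C K K12 by (simp add: d_def)
    have leY: "cmod (x k) \<le> Y" if "1 \<le> k" "k \<le> s" for k
      using that by (auto simp: Y_def intro!: Max_ge)
    have leZ: "cmod (x k) \<le> Z" if "s + 1 \<le> k" "k \<le> n" for k
      using that by (auto simp: Z_def intro!: Max_ge)
    have Y0: "0 \<le> Y" using leY[of 1] assms norm_ge_zero order_trans by (metis order_refl)
    have Z0: "0 \<le> Z" using order_trans[OF norm_ge_zero leZ[of n]] assms by simp
    have "Y ^ (2 * m) \<le> (\<Sum>k=1..s. cmod (x k) ^ (2 * m))"
      unfolding Y_def using assms by (intro Max_norm_power_le_sum) auto
    then have "K1 * Y ^ (2 * m) \<le> K1 * (\<Sum>k=1..s. cmod (x k) ^ (2 * m))"
      using K12 by simp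
    also have "\<dots> \<le> Re (hermitian_form m s (sub_tensor 0 A) x)"
      using assms B eigB by (intro hermitian_form_ge_eigenvalue_bound) (auto simp: hermitian_pos_def_def)
    finally have fB: "K1 * Y ^ (2 * m) \<le> Re (hermitian_form m s (sub_tensor 0 A) x)" .
    have "Z ^ (2 * m) \<le> (\<Sum>k=s+1..n. cmod (x k) ^ (2 * m))"
      unfolding Z_def using assms by (intro Max_norm_power_le_sum) auto
    also have "\<dots> = (\<Sum>k=1..n-s. cmod (x (k + s)) ^ (2 * m))"
      using assms sum.shift_bounds_cl_nat_ivl[of "\<lambda>k. cmod (x k) ^ (2 * m)" 1 s "n - s"]
      by (simp add: add.commute)
    finally have "K2 * Z ^ (2 * m) \<le> K2 * (\<Sum>k=1..n-s. cmod (x (k + s)) ^ (2 * m))"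
      using K12 by simp
    also have "\<dots> \<le> Re (hermitian_form m (n - s) (sub_tensor s A) (\<lambda>k. x (k + s)))"
      using assms D eigD by (intro hermitian_form_ge_eigenvalue_bound) (auto simp: hermitian_pos_def_def)
    finally have fD: "K2 * Z ^ (2 * m) \<le> Re (hermitian_form m (n - s) (sub_tensor s A) (\<lambda>k. x (k + s)))" .
    have "cmod M < K1 * Y ^ (2 * m) + K2 * Z ^ (2 * m)"
    proof (cases "Z \<le> 1 / d * Y")
      case True
      have "1 / d * Y \<le> 1 * Y" using d Y0 by (intro mult_right_mono) auto
      then have all_le: "cmod (x k) \<le> Y" if "k \<in> {1..n}" for k
        using leY[of k] leZ[of k] True that by (cases "k \<le> s") auto
      \<comment> \<open>In this case \<open>Y\<close> dominates all coordinates, so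
        \<open>Y = 0\<close> would force \<open>x\<close> to vanish; \<open>Y > 0\<close> is needed
        for the strict bound.\<close>
      have "Y \<noteq> 0"
      proof
        assume "Y = 0"
        then have "\<not> nonzero_vec n x" using all_le by (fastforce simp: nonzero_vec_def)
        with x show False by simp
      qed
      have "cmod (monom_at x (is @ js)) \<le> 1 / d * Y ^ (2 * m)"
        if ij: "(is, js) \<in> mixed_pairs m n s" for "is" js
      proof -
        have ij': "length is = m" "length js = m" "set (is @ js) \<subseteq> {1..n}"
          using ij by (auto simp: mixed_pairs_def index_lists_def)
        \<comment> \<open>A mixed pair contains an index above \<open>s\<close>, and its coordinate
          supplies the small factor.\<close>
        from ij obtain k where k: "k \<in> set (is @ js)" "s + 1 \<le> k"
          by (auto simp: mixed_pairs_def)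
        have "cmod (x k) \<le> 1 / d * Y" using leZ[of k] k ij' True by fastforce
        then have "cmod (monom_at x (is @ js)) \<le> 1 / d * Y ^ length (is @ js)"
          using all_le ij' k by (intro norm_monom_at_le_small_factor) auto
        then show ?thesis using ij' by (simp add: mult_2)
      qed
      then have "cmod M \<le> C * (mixed_max m n s A * (1 / d * Y ^ (2 * m)))"
        unfolding M_def C_def using K d Y0 by (intro norm_mixed_sum_le) auto
      also have "\<dots> = (C * K / d) * Y ^ (2 * m)" using K by simp
      also have "\<dots> < K1 * Y ^ (2 * m)"
      proof (rule mult_strict_right_mono)
        have "C * K < K1 * d" using K12 by (simp add: d_def field_simps)
        then show "C * K / d < K1" using d by (simp add: field_simps)
        show "0 < Y ^ (2 * m)" using \<open>Y \<noteq> 0\<close> Y0 by simp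
      qed
      also have "\<dots> \<le> K1 * Y ^ (2 * m) + K2 * Z ^ (2 * m)" using K12 Z0 by simp
      finally show ?thesis .
    next
      case False
      \<comment> \<open>Here \<open>Z\<close> exceeds the nonnegative \<open>Y / d\<close>, so it is
        positive, and \<open>Z * d\<close> bounds the coordinates of both groups.\<close>
      have "0 \<le> 1 / d * Y" using d Y0 by simp
      with False have "0 < Z" by linarith
      have "Z * 1 \<le> Z * d" using Z0 d by (intro mult_left_mono) auto
      moreover have "Y \<le> Z * d" using False d by (simp add: field_simps)
      ultimately have all_le: "cmod (x k) \<le> Z * d" if "k \<in> {1..n}" for k
        using leY[of k] leZ[of k] that by (cases "k \<le> s") auto
      have "cmod (monom_at x (is @ js)) \<le> (Z * d) ^ (2 * m)"
        if ij: "(is, js) \<in> mixed_pairs m n s" for "is" js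
      proof -
        have ij': "length is = m" "length js = m" "set (is @ js) \<subseteq> {1..n}"
          using ij by (auto simp: mixed_pairs_def index_lists_def)
        then have "cmod (monom_at x (is @ js)) \<le> (Z * d) ^ length (is @ js)"
          using all_le by (intro norm_monom_at_le) auto
        then show ?thesis using ij' by (simp add: mult_2)
      qed
      then have "cmod M \<le> C * (mixed_max m n s A * (Z * d) ^ (2 * m))"
        unfolding M_def C_def using K d Z0 by (intro norm_mixed_sum_le) auto
      also have "\<dots> = (C * d ^ (2 * m) * K) * Z ^ (2 * m)"
        using K by (simp add: power_mult_distrib)
      also have "\<dots> < K2 * Z ^ (2 * m)"
      proof (rule mult_strict_right_mono)
        have "C * d ^ (2 * m) * K < (C + 1) * d ^ (2 * m) * K"
          using d K by simp
        \<comment> \<open>The hypothesis on \<open>c\<close>, multiplied by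
          \<open>K\<close>.\<close>
        also have "\<dots> \<le> K2" using cK K by (simp add: c_def d_def pos_le_divide_eq)
        finally show "C * d ^ (2 * m) * K < K2" .
        show "0 < Z ^ (2 * m)" using \<open>0 < Z\<close> by simp
      qed
      also have "\<dots> \<le> K1 * Y ^ (2 * m) + K2 * Z ^ (2 * m)" using K12 Y0 by simp
      finally show ?thesis .
    qed
    \<comment> \<open>In the worst case the mixed part lowers the form by its full modulus, which
      stays strictly below the two block bounds together.\<close>
    moreover have "- cmod M \<le> Re M" using abs_Re_le_cmod[of M] by linarith
    moreover have "hermitian_form m n A x = hermitian_form m s (sub_tensor 0 A) x
        + hermitian_form m (n - s) (sub_tensor s A) (\<lambda>k. x (k + s)) + M"
      unfolding M_def using assms by (intro hermitian_form_split) auto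
    ultimately show "0 < Re (hermitian_form m n A x)" using fB fD by simp
  qed (use herm in \<open>auto intro: hermitian_form_Reals\<close>)
  with c_pos show ?thesis by blast
qed

end
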